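(* Let $(A,A^* )$ be a tridiagonal pair of $q$-Racah type of diameter $d$ satisfying the Specialization Assumption (stated in the context). For $q=e^{\mathrm i\pi/N}$ and an integer $N$ with $2\le N\le d$, assume that the vector space $V$ is irreducible under the action of the specialized operators $A$ and $A^*$ (there is no subspace $W$ with $AW\subseteq W$, $A^*W\subseteq W$, $W\ne0$, $W\ne V$). Then the pair of operators $A,A^*$ forms a cyclic tridiagonal pair of cyclicity $N$.
   Context: Tridiagonal (TD) pair: for a finite-dimensional vector space $V\ne0$ over a field $\mathbb K$, an ordered pair of linear maps $A,A^*:V\to V$ ($A^*$ is not the adjoint of $A$) such that (i) both are diagonalizable; (ii) there is an ordering $V_0,\dots,V_d$ of the eigenspaces of $A$ with $A^*V_p\subseteq V_{p-1}+V_p+V_{p+1}$ ($V_{-1}=V_{d+1}=0$); (iii) there is an ordering $V_0^*,\dots,V_\delta^*$ of the eigenspaces of $A^*$ with $AV^*_p\subseteq V^*_{p-1}+V^*_p+V^*_{p+1}$ ($V^*_{-1}=V^*_{\delta+1}=0$); (iv) no subspace $W\neq0,V$ satisfies $AW\subseteq W$ and $A^*W\subseteq W$. It is known that $d=\delta$, called the diameter. Orderings as in (ii), (iii) are called standard. $q$-Racah type, over $\mathbb K=\mathbb C(q)$ with $q$ an indeterminate: for standard orderings the eigenvalue of $A$ on $V_n=V_n(q)$ is $\theta_n(q)=a+bq^{2n}+cq^{-2n}$ and that of $A^*$ on $V^*_n=V^*_n(q)$ is $\theta^*_n(q)=a^*+b^*q^{2n}+c^*q^{-2n}$, $0\le n\le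 d$, with scalars $a,b,c,a^*,b^*,c^*$ and $b,c,b^*,c^*\ne0$. Specialization Assumption: there exist two bases of $V$, in the first of which the matrix representing $A$ is diagonal and the one representing $A^*$ is block tridiagonal, and in the second of which the matrix representing $A$ is block tridiagonal and the one representing $A^*$ is diagonal, such that, specializing $q$ to $e^{\mathrm i\pi/N}$: (i) all entries of $A$ and $A^*$ with respect to these bases are finite; (ii) all entries of the transition matrix between the two bases are finite; (iii) $c/b\neq q^{2m}$ and $c^*/b^*\neq q^{2m'}$ for all $m,m'\in\{0,\dots,N-1\}$. The specialized operators $A,A^*$ are the linear maps given by the matrices of $A,A^*$ evaluated at $q=e^{\mathrm i\pi/N}$; point (ii) is used to regard the specializations in the first and in the second basis as the same pair of linear maps $V\to V$ (where $V$ now denotes the specialized, complex, vector space). Cyclic tridiagonal pair of cyclicity $N$ on $V$: an ordered pair of linear maps $C,C^*:V\to V$ such that (i) each is diagonalizable; (ii) there is an ordering $\{V_p\}_{p\in\mathbb Z_N}$ (with $\mathbb Z_N=\mathbb Z/N\mathbb Z$) of the eigenspaces of $C$ with $C^*V_p\subseteq V_{p-1}+V_p+V_{p+1}$; (iii) there is an ordering $\{V^*_p\}_{p\in\mathbb Z_N}$ of the eigenspaces of $C^*$ with $CV^*_p\subseteq V^*_{p-1}+V^*_p+V^*_{p+1}$; (iv) there is no subspace $W\ne0,V$ with $CW\subseteq W$, $C^*W\subseteq W$. *)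

theory Defs
  imports "HOL-Analysis.Analysis" "HOL-Computational_Algebra.Computational_Algebra"
    "HOL-Computational_Algebra.Field_as_Ring"
begin

section \<open>Tridiagonal and cyclic tridiagonal pairs\<close>

text \<open>The vector space is the whole type of vectors; \<open>smul\<close> is its scalar multiplication.\<close>

definition eigenspace ::
    "('a::field \<Rightarrow> 'b::ab_group_add \<Rightarrow> 'b) \<Rightarrow>
     ('b \<Rightarrow> 'b) \<Rightarrow> 'a \<Rightarrow> 'b set" where
  "eigenspace smul f \<theta> = {v. f v = smul \<theta> v}"

definition eigenspaces ::
    "('a::field \<Rightarrow> 'b::ab_group_add \<Rightarrow> 'b) \<Rightarrow>
     ('b \<Rightarrow> 'b) \<Rightarrow> 'b set set" where
  "eigenspaces smul f = {eigenspace smul f \<theta> | \<theta>. eigenspace smul f \<theta> \<noteq> {0}}"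

definition diagonalizable ::
    "('a::field \<Rightarrow> 'b::ab_group_add \<Rightarrow> 'b) \<Rightarrow>
     ('b \<Rightarrow> 'b) \<Rightarrow> bool" where
  "diagonalizable smul f \<longleftrightarrow> module.span smul (\<Union>(eigenspaces smul f)) = UNIV"

definition irreducible_pair ::
    "('a::field \<Rightarrow> 'b::ab_group_add \<Rightarrow> 'b) \<Rightarrow>
     ('b \<Rightarrow> 'b) \<Rightarrow> ('b \<Rightarrow> 'b) \<Rightarrow> bool" where
  "irreducible_pair smul f g \<longleftrightarrow>
     \<not> (\<exists>W. module.subspace smul W \<and> W \<noteq> {0} \<and> W \<noteq> UNIV \<and> f ` W \<subseteq> W \<and> g ` W \<subseteq> W)"

definition finite_dim_nonzero :: "('a::field \<Rightarrow> 'b::ab_group_add \<Rightarrow> 'b) \<Rightarrow> bool" where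
  "finite_dim_nonzero smul \<longleftrightarrow> (\<exists>B. finite B \<and> module.span smul B = UNIV) \<and> (\<exists>v::'b. v \<noteq> 0)"

text \<open>
  An ordering \<open>E 0, \<dots>, E d\<close> of all the eigenspaces of \<open>f\<close> on which \<open>g\<close> acts
  block tridiagonally. Sums of subspaces are pointwise sums of sets.
\<close>

definition standard_ordering ::
    "('a::field \<Rightarrow> 'b::ab_group_add \<Rightarrow> 'b) \<Rightarrow>
     ('b \<Rightarrow> 'b) \<Rightarrow> ('b \<Rightarrow> 'b) \<Rightarrow> nat \<Rightarrow> (nat \<Rightarrow> 'b set) \<Rightarrow> bool" where
  "standard_ordering smul f g d E \<longleftrightarrow>
     bij_betw E {0..d} (eigenspaces smul f) \<and>
     (\<forall>p\<in>{0..d}. g ` E p \<subseteq>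
        (if p = 0 then {0} else E (p - 1)) + E p + (if p = d then {0} else E (p + 1)))"

definition td_pair ::
    "('a::field \<Rightarrow> 'b::ab_group_add \<Rightarrow> 'b) \<Rightarrow>
     ('b \<Rightarrow> 'b) \<Rightarrow> ('b \<Rightarrow> 'b) \<Rightarrow> bool" where
  "td_pair smul f g \<longleftrightarrow>
     finite_dim_nonzero smul \<and> Vector_Spaces.linear smul smul f \<and> Vector_Spaces.linear smul smul g \<and>
     diagonalizable smul f \<and> diagonalizable smul g \<and>
     (\<exists>d E. standard_ordering smul f g d E) \<and>
     (\<exists>\<delta> E. standard_ordering smul g f \<delta> E) \<and>
     irreducible_pair smul f g"

text \<open>\<open>\<int>/N\<int>\<close> is represented by the residues \<open>{0..<N}\<close>, and indices are reduced modulo \<open>N\<close>.\<close>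

definition cyclic_ordering ::
    "('a::field \<Rightarrow> 'b::ab_group_add \<Rightarrow> 'b) \<Rightarrow>
     ('b \<Rightarrow> 'b) \<Rightarrow> ('b \<Rightarrow> 'b) \<Rightarrow> nat \<Rightarrow> (int \<Rightarrow> 'b set) \<Rightarrow> bool" where
  "cyclic_ordering smul f g N E \<longleftrightarrow>
     bij_betw E {0..<int N} (eigenspaces smul f) \<and>
     (\<forall>p\<in>{0..<int N}. g ` E p \<subseteq> E ((p - 1) mod int N) + E p + E ((p + 1) mod int N))"

definition cyclic_td_pair ::
    "('a::field \<Rightarrow> 'b::ab_group_add \<Rightarrow> 'b) \<Rightarrow>
     nat \<Rightarrow> ('b \<Rightarrow> 'b) \<Rightarrow> ('b \<Rightarrow> 'b) \<Rightarrow> bool" where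
  "cyclic_td_pair smul N f g \<longleftrightarrow>
     finite_dim_nonzero smul \<and> Vector_Spaces.linear smul smul f \<and> Vector_Spaces.linear smul smul g \<and>
     diagonalizable smul f \<and> diagonalizable smul g \<and>
     (\<exists>E. cyclic_ordering smul f g N E) \<and>
     (\<exists>E. cyclic_ordering smul g f N E) \<and>
     irreducible_pair smul f g"


section \<open>Matrices with respect to a basis\<close>

text \<open>Bases are families indexed by a finite type, so that matrices are those of HOL-Analysis.\<close>

definition is_basis ::
    "('a::field \<Rightarrow> 'b::ab_group_add \<Rightarrow> 'b) \<Rightarrow>
     ('n::finite \<Rightarrow> 'b) \<Rightarrow> bool" where
  "is_basis smul b \<longleftrightarrow> inj b \<and> \<not> module.dependent smul (range b) \<and> module.span smul (range b) = UNIV"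

definition operator_matrix ::
    "('a::field \<Rightarrow> 'b::ab_group_add \<Rightarrow> 'b) \<Rightarrow>
     ('n::finite \<Rightarrow> 'b) \<Rightarrow> ('b \<Rightarrow> 'b) \<Rightarrow> 'a ^ 'n ^ 'n" where
  "operator_matrix smul b f = (\<chi> i j. module.representation smul (range b) (f (b j)) (b i))"

text \<open>Column \<open>j\<close> of the transition matrix holds the \<open>b\<close>-coordinates of \<open>b' j\<close>.\<close>

definition transition_matrix ::
    "('a::field \<Rightarrow> 'b::ab_group_add \<Rightarrow> 'b) \<Rightarrow>
     ('n::finite \<Rightarrow> 'b) \<Rightarrow> ('n \<Rightarrow> 'b) \<Rightarrow> 'a ^ 'n ^ 'n" where
  "transition_matrix smul b b' = (\<chi> i j. module.representation smul (range b) (b' j) (b i))"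

definition diagonal_matrix :: "'a::zero ^ 'n ^ 'n \<Rightarrow> bool" where
  "diagonal_matrix M \<longleftrightarrow> (\<forall>i j. i \<noteq> j \<longrightarrow> M $ i $ j = 0)"

text \<open>\<open>k i\<close> is the number of the block that contains the index \<open>i\<close>.\<close>

definition block_tridiagonal :: "('n \<Rightarrow> nat) \<Rightarrow> 'a::zero ^ 'n ^ 'n \<Rightarrow> bool" where
  "block_tridiagonal k M \<longleftrightarrow> (\<forall>i j. M $ i $ j \<noteq> 0 \<longrightarrow> k i \<le> k j + 1 \<and> k j \<le> k i + 1)"

text \<open>
  A basis in which \<open>f\<close> is diagonal and \<open>g\<close> is block tridiagonal, the \<open>p\<close>-th block
  consisting of the basis vectors in the eigenspace \<open>E p\<close> of \<open>f\<close>.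
\<close>

definition adapted_basis ::
    "('a::field \<Rightarrow> 'b::ab_group_add \<Rightarrow> 'b) \<Rightarrow>
     ('b \<Rightarrow> 'b) \<Rightarrow> ('b \<Rightarrow> 'b) \<Rightarrow> nat \<Rightarrow> (nat \<Rightarrow> 'b set) \<Rightarrow> ('n::finite \<Rightarrow> 'b) \<Rightarrow> bool" where
  "adapted_basis smul f g d E b \<longleftrightarrow>
     is_basis smul b \<and> diagonal_matrix (operator_matrix smul b f) \<and>
     (\<exists>k. (\<forall>i. k i \<le> d \<and> b i \<in> E (k i)) \<and> block_tridiagonal k (operator_matrix smul b g))"


section \<open>Rational functions and their specialization\<close>

type_synonym ratfun = "complex poly fract"

definition indet :: ratfun where
  "indet = Fract [:0, 1:] 1"

text \<open>\<open>quot_of_fract\<close> yields numerator and denominator in lowest terms.\<close>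

definition finite_at :: "complex \<Rightarrow> ratfun \<Rightarrow> bool" where
  "finite_at z r \<longleftrightarrow> poly (snd (quot_of_fract r)) z \<noteq> 0"

text \<open>The value of a rational function at \<open>z\<close>; only meaningful if it is finite there.\<close>

definition value_at :: "complex \<Rightarrow> ratfun \<Rightarrow> complex" where
  "value_at z r = poly (fst (quot_of_fract r)) z / poly (snd (quot_of_fract r)) z"

definition matrix_finite_at :: "complex \<Rightarrow> ratfun ^ 'n ^ 'm \<Rightarrow> bool" where
  "matrix_finite_at z M \<longleftrightarrow> (\<forall>i j. finite_at z (M $ i $ j))"

definition specialize_matrix :: "complex \<Rightarrow> ratfun ^ 'n ^ 'm \<Rightarrow> complex ^ 'n ^ 'm" where
  "specialize_matrix z M = (\<chi> i j. value_at z (M $ i $ j))"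

definition q_racah_eigenvalue :: "ratfun \<Rightarrow> ratfun \<Rightarrow> ratfun \<Rightarrow> nat \<Rightarrow> ratfun" where
  "q_racah_eigenvalue a b c n = a + b * indet ^ (2 * n) + c * inverse indet ^ (2 * n)"

text \<open>
  Both standard orderings have length \<open>d + 1\<close>, where \<open>d\<close> is the diameter.
\<close>

definition q_racah_td_pair ::
    "(ratfun \<Rightarrow> 'v \<Rightarrow> 'v::ab_group_add) \<Rightarrow> ('v \<Rightarrow> 'v) \<Rightarrow> ('v \<Rightarrow> 'v) \<Rightarrow> nat \<Rightarrow>
     (nat \<Rightarrow> 'v set) \<Rightarrow> (nat \<Rightarrow> 'v set) \<Rightarrow>
     ratfun \<Rightarrow> ratfun \<Rightarrow> ratfun \<Rightarrow> ratfun \<Rightarrow> ratfun \<Rightarrow> ratfun \<Rightarrow> bool" where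
  "q_racah_td_pair smul A As d E Es a b c as bs cs \<longleftrightarrow>
     td_pair smul A As \<and>
     standard_ordering smul A As d E \<and>
     standard_ordering smul As A d Es \<and>
     b \<noteq> 0 \<and> c \<noteq> 0 \<and> bs \<noteq> 0 \<and> cs \<noteq> 0 \<and>
     (\<forall>n\<in>{0..d}. E n = eigenspace smul A (q_racah_eigenvalue a b c n)) \<and>
     (\<forall>n\<in>{0..d}. Es n = eigenspace smul As (q_racah_eigenvalue as bs cs n))"

text \<open>
  The assumption on two bases \<open>u\<close>, \<open>us\<close> that makes the specialization of \<open>q\<close> to \<open>z\<close> possible.
  The blocks of the block tridiagonal matrices are those of the standard orderings.
  In the last two clauses a pole of \<open>c / b\<close> at \<open>z\<close> counts as being different from
  every power of \<open>z\<close>.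
\<close>

definition specialization_assumption ::
    "(ratfun \<Rightarrow> 'v \<Rightarrow> 'v::ab_group_add) \<Rightarrow> ('v \<Rightarrow> 'v) \<Rightarrow> ('v \<Rightarrow> 'v) \<Rightarrow> nat \<Rightarrow>
     (nat \<Rightarrow> 'v set) \<Rightarrow> (nat \<Rightarrow> 'v set) \<Rightarrow> ratfun \<Rightarrow> ratfun \<Rightarrow> ratfun \<Rightarrow> ratfun \<Rightarrow>
     nat \<Rightarrow> complex \<Rightarrow> ('n::finite \<Rightarrow> 'v) \<Rightarrow> ('n \<Rightarrow> 'v) \<Rightarrow> bool" where
  "specialization_assumption smul A As d E Es b c bs cs N z u us \<longleftrightarrow>
     adapted_basis smul A As d E u \<and>
     adapted_basis smul As A d Es us \<and>
     matrix_finite_at z (operator_matrix smul u A) \<and>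
     matrix_finite_at z (operator_matrix smul u As) \<and>
     matrix_finite_at z (operator_matrix smul us A) \<and>
     matrix_finite_at z (operator_matrix smul us As) \<and>
     matrix_finite_at z (transition_matrix smul u us) \<and>
     (\<forall>m\<in>{0..<N}. \<not> (finite_at z (c / b) \<and> value_at z (c / b) = z ^ (2 * m))) \<and>
     (\<forall>m\<in>{0..<N}. \<not> (finite_at z (cs / bs) \<and> value_at z (cs / bs) = z ^ (2 * m)))"

text \<open>
  The specialization of an operator, as a linear map on coordinate vectors with respect to \<open>u\<close>.
  The specialized transition matrix intertwines it with the one computed in another basis, and
  identifies the two when it is invertible.
\<close>

definition specialized_operator ::
    "(ratfun \<Rightarrow> 'v \<Rightarrow> 'v::ab_group_add) \<Rightarrow> complex \<Rightarrow> ('n::finite \<Rightarrow> 'v) \<Rightarrow> ('v \<Rightarrow> 'v) \<Rightarrow>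
     complex ^ 'n \<Rightarrow> complex ^ 'n" where
  "specialized_operator smul z u f =
     (\<lambda>x. specialize_matrix z (operator_matrix smul u f) *v x)"

end

theory Submission
  imports Defs
begin

text \<open>
  At \<open>z = exp (i \<pi> / N)\<close> the eigenvalues \<open>\<theta> n = a + b q ^ (2n) + c q ^ (-2n)\<close> become \<open>N\<close>-periodic
  in \<open>n\<close>, so the blocks of the standard orderings that are congruent modulo \<open>N\<close> merge and
  block tridiagonality becomes cyclic. Since
  \<open>\<theta> m - \<theta> n = (q ^ (2m) - q ^ (2n)) (b - c q ^ (-2(m + n)))\<close>, the condition on \<open>c / b\<close> keeps
  the \<open>N\<close> merged eigenvalues distinct, unless \<open>b\<close> and \<open>c\<close> both vanish at \<open>z\<close>; but then one of the
  two operators is scalar, and an eigenvector of the other spans a proper invariant subspace.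
  The rescaled transition matrix specializes to a nonzero intertwiner. Its image is invariant
  under the operators on the first side, so by irreducibility it is invertible, and the second
  ordering can be read off from its columns.
\<close>

section \<open>Specialization of rational functions\<close>

text \<open>The reduced denominator divides every other denominator of \<open>r\<close>, so any
  fraction whose denominator survives at \<open>z\<close> gives the same value. The arithmetic rules
  below can thus be checked on arbitrary representatives.\<close>

lemma specializes_iff:
  "finite_at z r \<and> value_at z r = w \<longleftrightarrow>
    (\<exists>p s. r = Fract p s \<and> poly s z \<noteq> 0 \<and> w = poly p z / poly s z)"
proof
  assume "finite_at z r \<and> value_at z r = w"
  then show "\<exists>p s. r = Fract p s \<and> poly s z \<noteq> 0 \<and> w = poly p z / poly s z"
    unfolding finite_at_def value_at_def
    by (intro exI[of _ "fst (quot_of_fract r)"] exI[of _ "snd (quot_of_fract r)"])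
      (auto simp: Fract_quot_of_fract)
next
  assume "\<exists>p s. r = Fract p s \<and> poly s z \<noteq> 0 \<and> w = poly p z / poly s z"
  then obtain p s where r: "r = Fract p s" and s: "poly s z \<noteq> 0" and w: "w = poly p z / poly s z"
    by blast
  define p' s' where "p' = fst (quot_of_fract r)" and "s' = snd (quot_of_fract r)"
  have "Fract p' s' = Fract p s"
    unfolding p'_def s'_def using r by (simp add: Fract_quot_of_fract)
  moreover have "s' \<noteq> 0" "s \<noteq> 0"
    unfolding s'_def using s by auto
  ultimately have eq: "p' * s = p * s'"
    by (simp add: eq_fract)
  have "coprime p' s'"
    unfolding p'_def s'_def by (rule coprime_quot_of_fract)
  then have "s' dvd s"
    using eq by (metis coprime_commute coprime_dvd_mult_right_iff dvd_triv_right)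
  then have s': "poly s' z \<noteq> 0"
    using s by (metis dvdE mult_zero_left poly_mult)
  have "poly p' z * poly s z = poly p z * poly s' z"
    using eq by (metis poly_mult)
  then have "poly p' z / poly s' z = w"
    using s s' w by (simp add: frac_eq_eq)
  then show "finite_at z r \<and> value_at z r = w"
    using s' unfolding finite_at_def value_at_def p'_def s'_def by simp
qed

lemma finite_at_Fract:
  "finite_at z r \<Longrightarrow> \<exists>p s. r = Fract p s \<and> poly s z \<noteq> 0 \<and> value_at z r = poly p z / poly s z"
  using specializes_iff by blast

lemma specializes_Fract:
  "poly s z \<noteq> 0 \<Longrightarrow> finite_at z (Fract p s) \<and> value_at z (Fract p s) = poly p z / poly s z"
  using specializes_iff by blast

lemma specializes_add:
  assumes "finite_at z r" "finite_at z r'"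
  shows "finite_at z (r + r')" "value_at z (r + r') = value_at z r + value_at z r'"
proof -
  obtain p s p' s' where r: "r = Fract p s" "r' = Fract p' s'" and
    nz: "poly s z \<noteq> 0" "poly s' z \<noteq> 0" and
    v: "value_at z r = poly p z / poly s z" "value_at z r' = poly p' z / poly s' z"
    using assms[THEN finite_at_Fract] by blast
  have nz': "s \<noteq> 0" "s' \<noteq> 0" using nz by auto
  have "r + r' = Fract (p * s' + p' * s) (s * s')"
    using r nz' by simp
  moreover have "poly (s * s') z \<noteq> 0" using nz by simp
  ultimately show "finite_at z (r + r')" "value_at z (r + r') = value_at z r + value_at z r'"
    using specializes_Fract[of "s * s'" z "p * s' + p' * s"] v nz by (auto simp: add_frac_eq)
qed

lemma specializes_mult:
  assumes "finite_at z r" "finite_at z r'"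
  shows "finite_at z (r * r')" "value_at z (r * r') = value_at z r * value_at z r'"
proof -
  obtain p s p' s' where r: "r = Fract p s" "r' = Fract p' s'" and
    nz: "poly s z \<noteq> 0" "poly s' z \<noteq> 0" and
    v: "value_at z r = poly p z / poly s z" "value_at z r' = poly p' z / poly s' z"
    using assms[THEN finite_at_Fract] by blast
  have "r * r' = Fract (p * p') (s * s')"
    using r by simp
  moreover have "poly (s * s') z \<noteq> 0" using nz by simp
  ultimately show "finite_at z (r * r')" "value_at z (r * r') = value_at z r * value_at z r'"
    using specializes_Fract[of "s * s'" z "p * p'"] v nz by auto
qed

lemma specializes_const:
  "finite_at z 0" "value_at z 0 = 0" "finite_at z 1" "value_at z 1 = 1"
  using specializes_Fract[of 1 z 0] specializes_Fract[of 1 z 1]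
  by (auto simp: Zero_fract_def One_fract_def)

lemma specializes_uminus:
  assumes "finite_at z r"
  shows "finite_at z (- r)" "value_at z (- r) = - value_at z r"
proof -
  have "finite_at z (- 1)" "value_at z (- 1) = - 1"
    using specializes_Fract[of 1 z "- 1"] by (auto simp: One_fract_def)
  then show "finite_at z (- r)" "value_at z (- r) = - value_at z r"
    using specializes_mult[of z "- 1" r] assms by auto
qed

lemma specializes_diff:
  assumes "finite_at z r" "finite_at z r'"
  shows "finite_at z (r - r')" "value_at z (r - r') = value_at z r - value_at z r'"
  using specializes_add[OF assms(1) specializes_uminus(1)[OF assms(2)]]
    specializes_uminus(2)[OF assms(2)] by auto

lemma specializes_power:
  assumes "finite_at z r"
  shows "finite_at z (r ^ n)" "value_at z (r ^ n) = value_at z r ^ n"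
proof -
  have "finite_at z (r ^ n) \<and> value_at z (r ^ n) = value_at z r ^ n"
    by (induction n) (auto simp: specializes_const specializes_mult assms)
  then show "finite_at z (r ^ n)" "value_at z (r ^ n) = value_at z r ^ n" by auto
qed

lemma specializes_sum:
  assumes "\<And>i. i \<in> S \<Longrightarrow> finite_at z (f i)"
  shows "finite_at z (sum f S)" "value_at z (sum f S) = (\<Sum>i\<in>S. value_at z (f i))"
proof -
  have "finite_at z (sum f S) \<and> value_at z (sum f S) = (\<Sum>i\<in>S. value_at z (f i))"
    using assms
    by (induction S rule: infinite_finite_induct) (auto simp: specializes_const specializes_add)
  then show "finite_at z (sum f S)" "value_at z (sum f S) = (\<Sum>i\<in>S. value_at z (f i))" by auto
qed

lemma specializes_inverse:
  assumes "finite_at z r" "value_at z r \<noteq> 0"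
  shows "finite_at z (inverse r)" "value_at z (inverse r) = inverse (value_at z r)"
proof -
  obtain p s where r: "r = Fract p s" "poly s z \<noteq> 0" "value_at z r = poly p z / poly s z"
    using finite_at_Fract[OF assms(1)] by blast
  then show "finite_at z (inverse r)" "value_at z (inverse r) = inverse (value_at z r)"
    using specializes_Fract[of p z s] assms(2) by auto
qed

section \<open>Poles and orders at a point\<close>

text \<open>The functions finite at \<open>z\<close> form a valuation ring: at a pole the reduced
  denominator vanishes, and the numerator, being coprime to it, cannot have the root
  \<open>z\<close> as well.\<close>

lemma finite_at_or_inverse:
  "finite_at z r \<or> finite_at z (inverse r) \<and> value_at z (inverse r) = 0"
proof (cases "finite_at z r")
  case False
  define p s where "p = fst (quot_of_fract r)" and "s = snd (quot_of_fract r)"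
  have r: "r = Fract p s"
    unfolding p_def s_def by (simp add: Fract_quot_of_fract)
  have "poly s z = 0"
    using False unfolding finite_at_def s_def by simp
  moreover have "coprime p s"
    unfolding p_def s_def by (rule coprime_quot_of_fract)
  ultimately have "poly p z \<noteq> 0"
    by (metis coprime_common_divisor is_unit_iff_degree poly_eq_0_iff_dvd degree_pCons_eq
        pCons_eq_0_iff zero_neq_one nat.distinct(1))
  then show ?thesis
    using specializes_Fract[of p z s] r \<open>poly s z = 0\<close> by simp
qed simp

text \<open>Divisibility in a valuation ring is total, so a finite set has an element of lowest
  order at \<open>z\<close>. It serves to normalize the entries of the transition matrix.\<close>

lemma exists_dominant_element:
  assumes "finite S" "S \<noteq> {}" "0 \<notin> S"
  shows "\<exists>x\<in>S. \<forall>y\<in>S. finite_at z (y / x)"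
  using assms
proof (induction S rule: finite_ne_induct)
  case (singleton x)
  then show ?case by (simp add: specializes_const)
next
  case (insert x S)
  then obtain m where m: "m \<in> S" "\<And>y. y \<in> S \<Longrightarrow> finite_at z (y / m)" by auto
  show ?case
  proof (cases "finite_at z (x / m)")
    case True
    then show ?thesis using m by auto
  next
    case False
    \<comment> \<open>Here \<open>x\<close> has lower order than the old minimum \<open>m\<close>,
      and dominates the rest because \<open>y / x\<close> factors through \<open>m\<close>.\<close>
    then have "finite_at z (m / x)"
      using finite_at_or_inverse[of z "x / m"] by simp
    then have "finite_at z (y / x)" if "y \<in> S" for y
    proof -
      have "m \<noteq> 0" using insert.prems m(1) by auto
      then have "y / x = (y / m) * (m / x)" by simp
      then show ?thesis using specializes_mult(1)[OF m(2)[OF that] \<open>finite_at z (m / x)\<close>] by metis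
    qed
    moreover have "finite_at z (x / x)"
      using insert.prems by (simp add: specializes_const)
    ultimately show ?thesis by blast
  qed
qed

lemma specializes_indet: "finite_at z indet" "value_at z indet = z"
  using specializes_Fract[of 1 z "[:0, 1:]"] by (auto simp: indet_def)

lemma specialize_matrix_mult:
  assumes "matrix_finite_at z M" "matrix_finite_at z M'"
  shows "specialize_matrix z (M ** M') = specialize_matrix z M ** specialize_matrix z M'"
  using assms
  by (simp add: specialize_matrix_def matrix_finite_at_def matrix_matrix_mult_def vec_eq_iff
      specializes_sum specializes_mult)

section \<open>Eigenvalues at a root of unity\<close>

text \<open>The two eigenvalues known to be finite do not by themselves bound the three scalars; the
  condition on \<open>c / b\<close> rules out poles that cancel. Once \<open>a\<close>,
  \<open>b\<close>, \<open>c\<close> are finite, periodicity and the dichotomy are computations with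
  complex numbers.\<close>

lemma q_racah_eigenvalue_specialization:
  assumes N: "2 \<le> N" and per: "z ^ (2 * N) = 1"
    and prim: "inj_on (\<lambda>n. z ^ (2 * n)) {..<N}"
    and nz: "b \<noteq> 0" "c \<noteq> 0"
    and fin: "finite_at z (q_racah_eigenvalue a b c 0)" "finite_at z (q_racah_eigenvalue a b c 1)"
    and ratio: "\<forall>m\<in>{0..<N}. \<not> (finite_at z (c / b) \<and> value_at z (c / b) = z ^ (2 * m))"
  defines "t \<equiv> \<lambda>n. value_at z (q_racah_eigenvalue a b c n)"
  shows "t (n mod N) = t n" and "inj_on t {..<N} \<or> (\<forall>n. t n = t 0)"
proof -
  have z0: "z \<noteq> 0" using per N by (auto simp: power_0_left)
  have q0: "indet \<noteq> 0"
    using specializes_indet(2)[of z] z0 specializes_const(2) by metis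
  note fq = specializes_indet[of z]
  have fi: "finite_at z (inverse indet)" "value_at z (inverse indet) = inverse z"
    using specializes_inverse[of z indet] fq z0 by auto
  have z2: "z ^ 2 \<noteq> 1"
    using inj_onD[OF prim, of 0 1] N by auto
  \<comment> \<open>This is the difference of the eigenvalues 0 and 1 divided by
    \<open>1 - indet ^ 2\<close>, whose value at \<open>z\<close> is nonzero; hence \<open>e\<close>
    is finite at \<open>z\<close>.\<close>
  define e where "e = b - c * inverse indet ^ 2"
  have e: "finite_at z e"
  proof -
    have "1 - indet ^ 2 \<noteq> 0"
      using specializes_diff(2)[of z 1 "indet ^ 2"] specializes_power[OF fq(1), of 2]
        specializes_const[of z] fq z2 by (metis right_minus_eq)
    moreover have "indet ^ 2 * inverse indet ^ 2 = 1"
      using q0 by (simp flip: power_mult_distrib)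
    then have "q_racah_eigenvalue a b c 0 - q_racah_eigenvalue a b c 1 = (1 - indet ^ 2) * e"
      unfolding q_racah_eigenvalue_def e_def mult_zero_right mult_1_right power_0 by algebra
    ultimately have "e = (q_racah_eigenvalue a b c 0 - q_racah_eigenvalue a b c 1) *
        inverse (1 - indet ^ 2)"
      by (simp add: field_simps)
    moreover have "finite_at z (inverse (1 - indet ^ 2))"
      using specializes_inverse(1)[of z "1 - indet ^ 2"] specializes_diff[of z 1 "indet ^ 2"]
        specializes_power[OF fq(1), of 2] specializes_const[of z] fq z2 by simp
    ultimately show ?thesis using specializes_mult(1) specializes_diff(1) fin by metis
  qed
  \<comment> \<open>A pole of \<open>c\<close> would force \<open>c / b\<close> to take the excluded value \<open>z ^ 2\<close>.\<close>
  have c: "finite_at z c"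
  proof (rule ccontr)
    assume "\<not> finite_at z c"
    then have ic: "finite_at z (inverse c)" "value_at z (inverse c) = 0"
      using finite_at_or_inverse by blast+
    \<comment> \<open>A pole of \<open>c\<close> kills the term \<open>e * inverse c\<close> at
      \<open>z\<close>, so only the power of \<open>indet\<close> contributes to the value of
      \<open>b / c\<close>.\<close>
    have bc: "b / c = inverse indet ^ 2 + e * inverse c"
      using nz q0 unfolding e_def by (simp add: field_simps)
    have "finite_at z (b / c)" "value_at z (b / c) = inverse z ^ 2"
      unfolding bc using ic fi e by (simp_all add: specializes_add specializes_mult specializes_power)
    then have "finite_at z (c / b)" "value_at z (c / b) = z ^ (2 * 1)"
      using specializes_inverse[of z "b / c"] z0 by (simp_all add: power_inverse)
    then show False using bspec[OF ratio, of 1] N by simp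
  qed
  have b: "finite_at z b"
  proof -
    have "b = e + c * inverse indet ^ 2" by (simp add: e_def)
    then show ?thesis using specializes_add(1)[OF e] specializes_mult(1)[OF c]
        specializes_power(1)[OF fi(1)] by metis
  qed
  have a: "finite_at z a"
  proof -
    have "a = q_racah_eigenvalue a b c 0 - (b + c)" by (simp add: q_racah_eigenvalue_def)
    then show ?thesis using specializes_diff(1)[OF fin(1)] specializes_add(1)[OF b c] by metis
  qed
  define \<alpha> \<beta> \<gamma> where "\<alpha> = value_at z a" and "\<beta> = value_at z b" and "\<gamma> = value_at z c"
  have t: "t n = \<alpha> + \<beta> * z ^ (2 * n) + \<gamma> / z ^ (2 * n)" for n
    unfolding t_def q_racah_eigenvalue_def \<alpha>_def \<beta>_def \<gamma>_def
    using a b c fq fi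
    by (simp add: specializes_add specializes_mult specializes_power divide_inverse
        flip: power_inverse)
  have zmod: "z ^ (2 * (n mod N)) = z ^ (2 * n)" for n
  proof -
    have "z ^ (2 * n) = z ^ (2 * (N * (n div N) + n mod N))" by simp
    also have "\<dots> = (z ^ (2 * N)) ^ (n div N) * z ^ (2 * (n mod N))"
      by (simp only: distrib_left power_add power_mult mult.assoc[symmetric])
    finally show ?thesis using per by simp
  qed
  show "t (n mod N) = t n" by (simp only: t zmod)
  show "inj_on t {..<N} \<or> (\<forall>n. t n = t 0)"
  proof (cases "\<beta> = 0 \<and> \<gamma> = 0")
    case True
    then show ?thesis by (simp add: t)
  next
    case False
    have "inj_on t {..<N}"
    proof (rule inj_onI, rule ccontr)
      fix m n assume mn: "m \<in> {..<N}" "n \<in> {..<N}" "t m = t n" "m \<noteq> n"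
      define x y where "x = z ^ (2 * m)" and "y = z ^ (2 * n)"
      have xy: "x \<noteq> y" "x \<noteq> 0" "y \<noteq> 0"
        using inj_onD[OF prim, of m n] mn z0 unfolding x_def y_def by auto
      have "\<beta> * x + \<gamma> / x = \<beta> * y + \<gamma> / y"
        using mn(3) by (simp add: t x_def y_def)
      then have "(x - y) * (\<beta> * x * y - \<gamma>) = 0"
        using xy by (simp add: field_simps)
      \<comment> \<open>In particular \<beta> = 0 would force \<gamma> = 0, which this case
        excludes; so \<open>b\<close> is invertible at \<open>z\<close> and \<open>c / b\<close> is
        finite there with value \<open>x * y\<close>.\<close>
      then have \<gamma>: "\<gamma> = \<beta> * (x * y)" using xy by (simp add: mult.assoc)
      then have \<beta>: "\<beta> \<noteq> 0" using False by auto
      \<comment> \<open>Reducing the exponent modulo \<open>N\<close> brings the value of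
        \<open>c / b\<close> into the range of excluded powers.\<close>
      have "x * y = z ^ (2 * ((m + n) mod N))"
        unfolding zmod x_def y_def by (simp add: power_add distrib_left)
      moreover have "finite_at z (c / b)" "value_at z (c / b) = x * y"
        using specializes_inverse[OF b] specializes_mult[OF c, of "inverse b"] \<beta> \<gamma>
        by (simp_all add: divide_inverse \<beta>_def[symmetric] \<gamma>_def[symmetric])
      ultimately show False using ratio N by (metis atLeastLessThan_iff mod_less_divisor order.strict_trans2 pos2 zero_le)
    qed
    then show ?thesis ..
  qed
qed

section \<open>Intertwiners and cyclic orderings\<close>

lemma diagonal_matrix_vector_mult:
  fixes D :: "'a::semiring_1 ^ 'n::finite ^ 'n"
  assumes "diagonal_matrix D"
  shows "(D *v w) $ i = D $ i $ i * w $ i"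
proof -
  have "(D *v w) $ i = (\<Sum>j\<in>UNIV. if j = i then D $ i $ i * w $ i else 0)"
    unfolding matrix_vector_mult_def vec_lambda_beta
  proof (rule sum.cong)
    fix j show "D $ i $ j * w $ j = (if j = i then D $ i $ i * w $ i else 0)"
      using assms unfolding diagonal_matrix_def by (cases "j = i") auto
  qed simp
  then show ?thesis by simp
qed

text \<open>The columns of \<open>P\<close> form an eigenbasis of \<open>F\<close>, column
  \<open>i\<close> having eigenvalue \<open>t (k i)\<close>. By periodicity and injectivity two
  columns share an eigenvalue exactly when their blocks agree modulo \<open>N\<close>, and adjacent
  blocks reduce to adjacent residues.\<close>

lemma cyclic_ordering_of_diagonalization:
  fixes F G P D X :: "'a::field ^ 'n::finite ^ 'n" and k :: "'n \<Rightarrow> nat" and t :: "nat \<Rightarrow> 'a"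
  assumes N: "0 < N" and P: "invertible P"
    and FP: "F ** P = P ** D" and GP: "G ** P = P ** X"
    and D: "diagonal_matrix D" "\<And>i. D $ i $ i = t (k i)"
    and X: "block_tridiagonal k X"
    and per: "\<And>n. t (n mod N) = t n" and inj: "inj_on t {..<N}"
    and surj: "{..<N} \<subseteq> range k"
  shows "diagonalizable (*s) ((*v) F) \<and> (\<exists>E. cyclic_ordering (*s) ((*v) F) ((*v) G) N E)"
proof -
  \<comment> \<open>\<open>S r\<close> collects the coordinate vectors supported on blocks of
    residue \<open>r\<close>; its image under \<open>P\<close> will be the eigenspace with index
    \<open>r\<close>.\<close>
  define S where "S r = {w::'a^'n. \<forall>i. w $ i \<noteq> 0 \<longrightarrow> int (k i mod N) = r}" for r
  define E where "E r = (*v) P ` S r" for r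
  have injP: "inj ((*v) P)"
    using P by (simp add: invertible_left_inverse matrix_left_invertible_injective)
  have surjP: "surj ((*v) P)"
    using P by (simp only: invertible_right_inverse matrix_right_invertible_surjective)
  have memE: "P *v w \<in> E r \<longleftrightarrow> w \<in> S r" for w r
    unfolding E_def by (rule inj_image_mem_iff[OF injP])
  have Dw: "(D *v w) $ i = t (k i) * w $ i" for w i
    using D by (simp add: diagonal_matrix_vector_mult)
  have F: "F *v (P *v w) = P *v (D *v w)" and G: "G *v (P *v w) = P *v (X *v w)" for w
    by (simp_all add: matrix_vector_mul_assoc FP GP)
  have eig: "P *v w \<in> eigenspace (*s) ((*v) F) \<mu> \<longleftrightarrow> (\<forall>i. w $ i \<noteq> 0 \<longrightarrow> t (k i) = \<mu>)" for w \<mu>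
  proof -
    have "P *v w \<in> eigenspace (*s) ((*v) F) \<mu> \<longleftrightarrow> P *v (D *v w) = P *v (\<mu> *s w)"
      by (simp add: eigenspace_def F vector_scalar_commute)
    also have "\<dots> \<longleftrightarrow> D *v w = \<mu> *s w"
      using injP by (simp only: inj_eq)
    finally show ?thesis by (auto simp: vec_eq_iff Dw)
  qed
  have E_eig: "E r = eigenspace (*s) ((*v) F) (t (nat r))" if r: "r \<in> {0..<int N}" for r
  proof -
    have "t (k i) = t (nat r) \<longleftrightarrow> int (k i mod N) = r" for i
      using per[of "k i"] inj_onD[OF inj, of "k i mod N" "nat r"] r N by (auto simp: nat_less_iff)
    then have "w \<in> S r \<longleftrightarrow> P *v w \<in> eigenspace (*s) ((*v) F) (t (nat r))" for w
      unfolding eig S_def by simp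
    then show ?thesis
      unfolding E_def using surjP by (auto simp: image_iff) (metis surjD)
  qed
  have axisS: "axis i 1 \<in> S r \<longleftrightarrow> int (k i mod N) = r" for i r
    by (auto simp: S_def axis_def)
  have axisP: "P *v w \<noteq> 0" if "w \<noteq> 0" for w
    using injD[OF injP, of w 0] that by auto
  have axis0: "axis i 1 \<noteq> (0::'a^'n)" for i by (simp add: axis_eq_0_iff)
  \<comment> \<open>Every residue is met by some block, which keeps each \<open>E r\<close> nonzero
    and, through a unit vector, tells the \<open>E r\<close> apart.\<close>
  have hit: "\<exists>i. axis i 1 \<in> S r" if "r \<in> {0..<int N}" for r
  proof -
    have "nat r \<in> range k" using that surj by (auto simp: nat_less_iff)
    then obtain i where "k i = nat r" by auto
    then have "axis i 1 \<in> S r" using that by (simp add: axisS nat_less_iff)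
    then show ?thesis ..
  qed
  have "bij_betw E {0..<int N} (eigenspaces (*s) ((*v) F))"
    unfolding bij_betw_def
  proof (intro conjI inj_onI equalityI subsetI)
    fix r s assume r: "r \<in> {0..<int N}" and "E r = E s"
    obtain i where i: "axis i 1 \<in> S r" using hit r by blast
    then have "axis i 1 \<in> S s" using \<open>E r = E s\<close> memE by blast
    then show "r = s" using i by (simp add: axisS)
  next
    fix V assume "V \<in> E ` {0..<int N}"
    then obtain r where r: "r \<in> {0..<int N}" "V = E r" by auto
    obtain i where i: "axis i 1 \<in> S r" using hit r by blast
    then have "P *v axis i 1 \<in> E r" by (simp only: memE)
    then have "E r \<noteq> {0}" using axisP axis0 by blast
    then show "V \<in> eigenspaces (*s) ((*v) F)"
      using r E_eig unfolding eigenspaces_def by auto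
  next
    fix V assume "V \<in> eigenspaces (*s) ((*v) F)"
    then obtain \<mu> where V: "V = eigenspace (*s) ((*v) F) \<mu>" "V \<noteq> {0}"
      unfolding eigenspaces_def by auto
    have "0 \<in> V" unfolding V(1) eigenspace_def by simp
    then obtain v where v: "v \<in> V" "v \<noteq> 0" using V(2) by blast
    obtain w where w: "v = P *v w" using surjP by (metis surjD)
    then have "w \<noteq> 0" using v by auto
    \<comment> \<open>Any nonzero coordinate of an eigenvector reveals its eigenvalue as that of a
      column, so there are no further eigenspaces.\<close>
    then obtain i where "w $ i \<noteq> 0" by (auto simp: vec_eq_iff)
    then have "t (k i) = \<mu>" using eig v(1) unfolding w V(1) by blast
    then have "\<mu> = t (k i mod N)" by (simp only: per)
    moreover have "int (k i mod N) \<in> {0..<int N}" using N by simp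
    ultimately show "V \<in> E ` {0..<int N}"
      using E_eig[of "int (k i mod N)"] V(1) by (metis image_eqI nat_int)
  qed
  moreover have "(*v) G ` E p \<subseteq> E ((p - 1) mod int N) + E p + E ((p + 1) mod int N)" for p
  proof
    fix v assume "v \<in> (*v) G ` E p"
    then obtain w where w: "w \<in> S p" "v = P *v (X *v w)"
      unfolding E_def image_image G by blast
    define m where "m i = int (k i mod N)" for i
    define y where "y = X *v w"
    \<comment> \<open>The conditions are made mutually exclusive because residues can coincide: for
      \<open>N = 2\<close> the two outer ones are equal, and \<open>y3\<close> is then zero.\<close>
    define y1 y2 y3 :: "'a^'n" where
      "y1 = (\<chi> i. if m i = (p - 1) mod int N then y $ i else 0)" and
      "y2 = (\<chi> i. if m i \<noteq> (p - 1) mod int N \<and> m i = p then y $ i else 0)" and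
      "y3 = (\<chi> i. if m i \<noteq> (p - 1) mod int N \<and> m i \<noteq> p then y $ i else 0)"
    \<comment> \<open>A nonzero coordinate \<open>i\<close> of \<open>X *v w\<close> comes from some
      \<open>j\<close> in the support of \<open>w\<close> with \<open>X $ i $ j\<close> nonzero, so
      \<open>k i\<close> and \<open>k j\<close> differ by at most one before reduction modulo
      \<open>N\<close>.\<close>
    have m: "m i \<in> {(p - 1) mod int N, p, (p + 1) mod int N}" if "y $ i \<noteq> 0" for i
    proof -
      obtain j where j: "X $ i $ j \<noteq> 0" "w $ j \<noteq> 0"
      proof -
        have "(\<Sum>j\<in>UNIV. X $ i $ j * w $ j) \<noteq> 0"
          using \<open>y $ i \<noteq> 0\<close> by (simp add: y_def matrix_vector_mult_def)
        then obtain j where "X $ i $ j * w $ j \<noteq> 0"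
          by (meson sum.not_neutral_contains_not_neutral)
        then show thesis using that by auto
      qed
      have p: "p = int (k j) mod int N"
        using j(2) w(1) unfolding S_def by (auto simp: zmod_int)
      have "k i \<le> k j + 1" "k j \<le> k i + 1"
        using X j(1) unfolding block_tridiagonal_def by auto
      then have "int (k i) = int (k j) - 1 \<or> int (k i) = int (k j) \<or> int (k i) = int (k j) + 1"
        by linarith
      then show ?thesis unfolding m_def zmod_int p by (auto simp: mod_simps)
    qed
    have "y1 \<in> S ((p - 1) mod int N)" "y2 \<in> S p" "y3 \<in> S ((p + 1) mod int N)"
      using m unfolding S_def y1_def y2_def y3_def m_def[symmetric] by (auto split: if_splits)
    moreover have "y = y1 + y2 + y3"
      unfolding y1_def y2_def y3_def by (auto simp: vec_eq_iff)
    then have "v = P *v y1 + P *v y2 + P *v y3"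
      using w(2) by (simp add: y_def[symmetric] matrix_vector_right_distrib)
    ultimately show "v \<in> E ((p - 1) mod int N) + E p + E ((p + 1) mod int N)"
      using memE by (metis set_plus_intro)
  qed
  ultimately have "cyclic_ordering (*s) ((*v) F) ((*v) G) N E"
    unfolding cyclic_ordering_def by blast
  moreover have "diagonalizable (*s) ((*v) F)"
    unfolding diagonalizable_def
  proof (intro equalityI subsetI UNIV_I)
    fix v :: "'a^'n"
    obtain w where w: "v = P *v w" using surjP by (metis surjD)
    have "P *v axis i 1 \<in> \<Union> (eigenspaces (*s) ((*v) F))" for i
    proof -
      have "P *v axis i 1 \<in> eigenspace (*s) ((*v) F) (t (k i))"
        unfolding eig by (auto simp: axis_def)
      moreover have "P *v axis i 1 \<noteq> 0" by (intro axisP axis0)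
      ultimately show ?thesis
        unfolding eigenspaces_def by blast
    qed
    then have "(\<Sum>i\<in>UNIV. w $ i *s (P *v axis i 1)) \<in> vec.span (\<Union> (eigenspaces (*s) ((*v) F)))"
      by (intro vec.span_sum vec.span_scale vec.span_base)
    moreover have "(\<Sum>i\<in>UNIV. w $ i *s (P *v axis i 1)) = v"
      unfolding w matrix_mult_sum[of P w]
      by (simp add: vec_eq_iff matrix_vector_mult_def column_def axis_def if_distrib cong: if_cong)
    ultimately show "v \<in> vec.span (\<Union> (eigenspaces (*s) ((*v) F)))" by simp
  qed
  ultimately show ?thesis by blast
qed

section \<open>Consequences of irreducibility\<close>

text \<open>Half of Schur's lemma: the intertwining relations make the image of \<open>P\<close>
  invariant under \<open>F\<close> and \<open>G\<close>. Being nonzero it is the whole space, and a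
  surjective square matrix is invertible.\<close>

lemma irreducible_intertwiner_invertible:
  fixes F G P D X :: "'a::field ^ 'n::finite ^ 'n"
  assumes irr: "irreducible_pair (*s) ((*v) F) ((*v) G)"
    and FP: "F ** P = P ** D" and GP: "G ** P = P ** X" and "P \<noteq> 0"
  shows "invertible P"
proof -
  have "vec.subspace (range ((*v) P))"
  proof (rule vec.subspaceI)
    show "0 \<in> range ((*v) P)"
      by (metis matrix_vector_mult_0_right rangeI)
  next
    fix x y assume "x \<in> range ((*v) P)" "y \<in> range ((*v) P)"
    then obtain v w where "x = P *v v" "y = P *v w" by blast
    then have "x + y = P *v (v + w)" by (simp only: matrix_vector_right_distrib)
    then show "x + y \<in> range ((*v) P)" by blast
  next
    fix c x assume "x \<in> range ((*v) P)"
    then obtain w where "x = P *v w" by blast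
    then have "c *s x = P *v (c *s w)" by (simp only: vector_scalar_commute)
    then show "c *s x \<in> range ((*v) P)" by blast
  qed
  moreover have "(*v) F ` range ((*v) P) \<subseteq> range ((*v) P)" "(*v) G ` range ((*v) P) \<subseteq> range ((*v) P)"
  proof -
    have "F *v (P *v w) = P *v (D *v w)" "G *v (P *v w) = P *v (X *v w)" for w
      by (simp_all add: matrix_vector_mul_assoc FP GP)
    then show "(*v) F ` range ((*v) P) \<subseteq> range ((*v) P)" "(*v) G ` range ((*v) P) \<subseteq> range ((*v) P)"
      by blast+
  qed
  moreover have "range ((*v) P) \<noteq> {0}"
  proof
    assume "range ((*v) P) = {0}"
    then have "P *v w = 0 *v w" for w
      using rangeI[of "(*v) P" w] by simp
    then show False using \<open>P \<noteq> 0\<close> matrix_eq by blast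
  qed
  ultimately have "surj ((*v) P)"
    using irr unfolding irreducible_pair_def by blast
  then show ?thesis
    by (simp only: invertible_right_inverse matrix_right_invertible_surjective)
qed

text \<open>The line through \<open>v\<close> is invariant under both maps. The two distinct indices
  ensure that the dimension is at least two, so that this line is proper.\<close>

lemma scalar_with_eigenvector_reducible:
  fixes F G :: "'a::field ^ 'n::finite ^ 'n"
  assumes F: "\<And>w. F *v w = t *s w" and G: "G *v v = \<mu> *s v" "v \<noteq> 0" and "(i::'n) \<noteq> j"
  shows "\<not> irreducible_pair (*s) ((*v) F) ((*v) G)"
proof
  assume irr: "irreducible_pair (*s) ((*v) F) ((*v) G)"
  define W where "W = range (\<lambda>c. c *s v)"
  have "vec.subspace W"
    unfolding W_def
    by (intro vec.subspaceI) (auto simp: image_iff intro: exI[of _ 0],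
        metis vector_sadd_rdistrib)
  moreover have "1 *s v \<in> W" unfolding W_def by blast
  then have "W \<noteq> {0}" using G by auto
  moreover have "(*v) F ` W \<subseteq> W" "(*v) G ` W \<subseteq> W"
    unfolding W_def by (auto simp: F G vector_scalar_commute)
  ultimately have "W = UNIV" using irr unfolding irreducible_pair_def by blast
  \<comment> \<open>If the line were everything, two different unit vectors would be multiples of
    \<open>v\<close>, which their coordinates at \<open>i\<close> and \<open>j\<close>
    contradict.\<close>
  then obtain c c' where "axis i 1 = c *s v" "axis j 1 = c' *s v"
    unfolding W_def by (metis UNIV_I imageE)
  then have "axis i 1 $ i = c * v $ i" "axis j 1 $ i = c' * v $ i" "axis j 1 $ j = c' * v $ j"
    by simp_all
  then have "c * v $ i = 1" "c' * v $ i = 0" "c' * v $ j = 1"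
    using \<open>i \<noteq> j\<close> by (simp_all add: axis_def)
  then show False by auto
qed

section \<open>Specialized tridiagonal pairs\<close>

text \<open>Expand \<open>v\<close> in the basis \<open>b\<close> and apply \<open>f\<close>.
  Allowing a second basis for the target lets the same formula serve operators and, with
  \<open>f\<close> the identity, changes of basis.\<close>

lemma representation_linear_image:
  fixes smul :: "'a::field \<Rightarrow> 'v::ab_group_add \<Rightarrow> 'v" and b b' :: "'n::finite \<Rightarrow> 'v"
  assumes "vector_space smul" "is_basis smul b" "is_basis smul b'" "Vector_Spaces.linear smul smul f"
  shows "(\<Sum>j\<in>UNIV. module.representation smul (range b') (f (b j)) x *
      module.representation smul (range b) v (b j)) = module.representation smul (range b') (f v) x"
proof -
  interpret vector_space smul by fact
  interpret f: Vector_Spaces.linear smul smul f by fact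
  let ?r = "representation (range b)"
  have b: "inj b" "independent (range b)" "span (range b) = UNIV"
    and b': "independent (range b')" "span (range b') = UNIV"
    using assms(2,3) unfolding is_basis_def by auto
  have "v = (\<Sum>w\<in>range b. smul (?r v w) w)"
    using sum_representation_eq[of "range b" v "range b"] b by simp
  also have "\<dots> = (\<Sum>j\<in>UNIV. smul (?r v (b j)) (b j))"
    using b(1) by (simp add: sum.reindex)
  finally have "f v = (\<Sum>j\<in>UNIV. smul (?r v (b j)) (f (b j)))"
    by (metis (no_types, lifting) f.scale f.sum sum.cong)
  then show ?thesis
    using b' by (simp add: representation_sum representation_scale mult.commute)
qed

text \<open>Entry \<open>i\<close>, \<open>j\<close> of either product is the coordinate of
  \<open>f (b' j)\<close> at \<open>b i\<close>.\<close>

lemma operator_matrix_transition_matrix: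
  fixes smul :: "'a::field \<Rightarrow> 'v::ab_group_add \<Rightarrow> 'v"
  assumes "vector_space smul" "is_basis smul b" "is_basis smul b'" "Vector_Spaces.linear smul smul f"
  shows "operator_matrix smul b f ** transition_matrix smul b b' =
    transition_matrix smul b b' ** operator_matrix smul b' f"
proof -
  interpret vector_space smul by fact
  have "Vector_Spaces.linear smul smul (\<lambda>x. x)" by (rule linear_ident)
  then show ?thesis
    using representation_linear_image[OF assms(1,2,2,4)]
      representation_linear_image[OF assms(1,3,2), of "\<lambda>x. x"]
    by (simp add: operator_matrix_def transition_matrix_def matrix_matrix_mult_def vec_eq_iff)
qed

lemma transition_matrix_nonzero:
  fixes smul :: "'a::field \<Rightarrow> 'v::ab_group_add \<Rightarrow> 'v"
  assumes "vector_space smul" "is_basis smul b" "is_basis smul b'"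
  shows "transition_matrix smul b b' \<noteq> 0"
proof
  interpret vector_space smul by fact
  assume 0: "transition_matrix smul b b' = 0"
  have b: "independent (range b)" "span (range b) = UNIV" and b': "independent (range b')"
    using assms(2,3) unfolding is_basis_def by auto
  \<comment> \<open>An index exists since types are nonempty; column \<open>i\<close> being zero
    makes a basis vector vanish.\<close>
  fix i
  have "representation (range b) (b' i) (b j) = 0" for j
    using 0 by (simp add: transition_matrix_def vec_eq_iff)
  then have "(\<Sum>w\<in>range b. smul (representation (range b) (b' i) w) w) = 0"
    by (intro sum.neutral) auto
  then have "b' i = 0"
    using sum_representation_eq[of "range b" "b' i" "range b"] b by simp
  then show False using b' dependent_zero by (metis rangeI)
qed

text \<open>No block is empty: an eigenvector in \<open>E n\<close> has a nonzero coordinate at some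
  \<open>u i\<close>, and comparing coefficients of its image under \<open>f\<close> there yields
  the eigenvalue of block \<open>k i\<close>.\<close>

lemma adapted_basis_blocks:
  fixes smul :: "'a::field \<Rightarrow> 'v::ab_group_add \<Rightarrow> 'v" and u :: "'n::finite \<Rightarrow> 'v"
  assumes "vector_space smul" "Vector_Spaces.linear smul smul f"
    and ad: "adapted_basis smul f g d E u" and ord: "standard_ordering smul f g d E"
    and E: "\<forall>n\<in>{0..d}. E n = eigenspace smul f (\<theta> n)"
  obtains k where "range k = {0..d}" "\<And>i. operator_matrix smul u f $ i $ i = \<theta> (k i)"
    "block_tridiagonal k (operator_matrix smul u g)"
proof -
  interpret vector_space smul by fact
  interpret f: Vector_Spaces.linear smul smul f by fact
  obtain k where k: "\<And>i. k i \<le> d" "\<And>i. u i \<in> E (k i)"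
    and bt: "block_tridiagonal k (operator_matrix smul u g)"
    and u: "is_basis smul u"
    using ad unfolding adapted_basis_def by blast
  have ind: "inj u" "independent (range u)" "span (range u) = UNIV"
    using u unfolding is_basis_def by auto
  have fu: "f (u i) = smul (\<theta> (k i)) (u i)" for i
    using k E by (fastforce simp: eigenspace_def)
  have rep: "representation (range u) (f (u j)) (u i) = (if i = j then \<theta> (k j) else 0)" for i j
    unfolding fu using ind
    by (simp add: representation_scale representation_basis inj_eq)
  have "n \<in> range k" if n: "n \<in> {0..d}" for n
  proof -
    have "E n \<in> eigenspaces smul f"
      using ord n unfolding standard_ordering_def bij_betw_def by blast
    then obtain \<mu> where "E n = eigenspace smul f \<mu>" "E n \<noteq> {0}"
      unfolding eigenspaces_def by auto
    moreover have "0 \<in> eigenspace smul f \<mu>"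
      by (simp add: eigenspace_def f.zero)
    ultimately obtain v where v: "v \<in> E n" "v \<noteq> 0" by blast
    define c where "c i = representation (range u) v (u i)" for i
    obtain i where i: "c i \<noteq> 0"
    proof (rule ccontr)
      assume "\<not> thesis"
      then have "(\<Sum>w\<in>range u. smul (representation (range u) v w) w) = 0"
        using that unfolding c_def by (intro sum.neutral) auto
      then show False
        using sum_representation_eq[of "range u" v "range u"] ind v by simp
    qed
    have "\<theta> n * c i = representation (range u) (f v) (u i)"
      using v(1) E n ind unfolding c_def by (auto simp: eigenspace_def representation_scale)
    also have "\<dots> = (\<Sum>j\<in>UNIV. representation (range u) (f (u j)) (u i) * c j)"
      using representation_linear_image[OF assms(1) u u assms(2)] by (simp add: c_def)
    also have "\<dots> = \<theta> (k i) * c i"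
      by (simp add: rep if_distrib if_distribR cong: if_cong)
    finally have "\<theta> n = \<theta> (k i)" using i by simp
    \<comment> \<open>Equal eigenvalues give equal eigenspaces, and injectivity of the ordering
      \<open>E\<close> turns this into \<open>n = k i\<close>.\<close>
    then have "E n = E (k i)" using E n k by simp
    then show ?thesis
      using ord n k(1)[of i] unfolding standard_ordering_def bij_betw_def
      by (metis atLeastAtMost_iff inj_onD rangeI zero_le)
  qed
  then have "range k = {0..d}" using k(1) by auto
  moreover have "operator_matrix smul u f $ i $ i = \<theta> (k i)" for i
    by (simp add: operator_matrix_def rep)
  ultimately show ?thesis using that bt by blast
qed

section \<open>Block structure at the root of unity\<close>

text \<open>The square of \<open>z\<close> is a primitive \<open>N\<close>-th root of unity.\<close>

lemma root_of_unity_square_powers: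
  assumes "1 \<le> N" and z: "z = exp (\<i> * of_real pi / of_nat N)"
  shows "z ^ (2 * N) = 1" "inj_on (\<lambda>n. z ^ (2 * n)) {..<N}"
proof -
  have pow: "z ^ (2 * n) = exp (2 * of_real pi * \<i> * of_nat n / of_nat N)" for n
    unfolding z by (simp add: exp_of_nat_mult[symmetric] algebra_simps)
  show "z ^ (2 * N) = 1"
    using complex_root_unity_eq[OF assms(1), of N 0] by (simp add: pow)
  show "inj_on (\<lambda>n. z ^ (2 * n)) {..<N}"
    using complex_root_unity_eq[OF assms(1)] by (auto simp: inj_on_def pow)
qed

text \<open>This treats one operator in its own diagonalizing basis, so that it applies to
  \<open>A\<close> with \<open>u\<close> and to \<open>As\<close> with \<open>us\<close>
  alike.\<close>

lemma specialized_blocks: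
  fixes smul :: "ratfun \<Rightarrow> 'v::ab_group_add \<Rightarrow> 'v" and u :: "'n::finite \<Rightarrow> 'v"
  assumes "vector_space smul" "Vector_Spaces.linear smul smul f"
    and ad: "adapted_basis smul f g d E u" and ord: "standard_ordering smul f g d E"
    and E: "\<forall>n\<in>{0..d}. E n = eigenspace smul f (q_racah_eigenvalue a b c n)"
    and nz: "b \<noteq> 0" "c \<noteq> 0" and N: "2 \<le> N" "N \<le> d"
    and z: "z = exp (\<i> * of_real pi / of_nat N)"
    and fin: "matrix_finite_at z (operator_matrix smul u f)"
    and ratio: "\<forall>m\<in>{0..<N}. \<not> (finite_at z (c / b) \<and> value_at z (c / b) = z ^ (2 * m))"
  obtains k t where "{..<N} \<subseteq> range k" "\<And>n. t (n mod N) = t n"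
    "inj_on t {..<N} \<or> (\<forall>n. t n = t 0)"
    "\<And>i. specialize_matrix z (operator_matrix smul u f) $ i $ i = t (k i)"
    "diagonal_matrix (specialize_matrix z (operator_matrix smul u f))"
    "block_tridiagonal k (specialize_matrix z (operator_matrix smul u g))"
proof -
  obtain k where k: "range k = {0..d}"
    "\<And>i. operator_matrix smul u f $ i $ i = q_racah_eigenvalue a b c (k i)"
    "block_tridiagonal k (operator_matrix smul u g)"
    using adapted_basis_blocks[OF assms(1,2) ad ord E] by blast
  \<comment> \<open>Every block is inhabited, so each eigenvalue is a diagonal entry of a matrix
    assumed finite at \<open>z\<close>.\<close>
  have finite: "finite_at z (q_racah_eigenvalue a b c n)" if "n \<le> d" for n
  proof -
    have "n \<in> range k" using k(1) that by simp
    then show ?thesis using k(2) fin unfolding matrix_finite_at_def by (metis rangeE)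
  qed
  have "1 \<le> N" using N by simp
  note eigenvalues = q_racah_eigenvalue_specialization[OF N(1) root_of_unity_square_powers[OF this z]
      nz finite finite ratio]
  show ?thesis
  proof (rule that[of k "\<lambda>n. value_at z (q_racah_eigenvalue a b c n)"])
    show "{..<N} \<subseteq> range k" using k(1) N by auto
    show "diagonal_matrix (specialize_matrix z (operator_matrix smul u f))"
      using ad unfolding adapted_basis_def diagonal_matrix_def
      by (simp add: specialize_matrix_def specializes_const)
    show "block_tridiagonal k (specialize_matrix z (operator_matrix smul u g))"
      using k(3) specializes_const(2) unfolding block_tridiagonal_def specialize_matrix_def
      by (metis vec_lambda_beta)
    show "specialize_matrix z (operator_matrix smul u f) $ i $ i =
        value_at z (q_racah_eigenvalue a b c (k i))" for i
      by (simp add: specialize_matrix_def k(2))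
  qed (use eigenvalues N in auto)
qed

lemma scalar_from_intertwiner:
  fixes F P D :: "'a::field ^ 'n::finite ^ 'n"
  assumes P: "invertible P" and FP: "F ** P = P ** D"
    and D: "diagonal_matrix D" "\<And>i. D $ i $ i = t"
  shows "F *v w = t *s w"
proof -
  have "surj ((*v) P)"
    using P by (simp only: invertible_right_inverse matrix_right_invertible_surjective)
  then obtain x where x: "w = P *v x" by (metis surjD)
  have "D *v x = t *s x"
    using D by (simp add: vec_eq_iff diagonal_matrix_vector_mult)
  moreover have "F *v w = P *v (D *v x)"
    unfolding x by (simp add: matrix_vector_mul_assoc FP)
  ultimately show ?thesis
    by (simp add: x vector_scalar_commute)
qed

text \<open>Each column of \<open>P\<close> is an eigenvector of \<open>G\<close>, nonzero because
  \<open>P\<close> is injective.\<close>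

lemma diagonal_eigenvector:
  fixes G P X :: "'a::field ^ 'n::finite ^ 'n"
  assumes "invertible P" "G ** P = P ** X" "diagonal_matrix X"
  obtains v \<mu> where "G *v v = \<mu> *s v" "v \<noteq> 0"
proof -
  fix i :: 'n
  have "X *v axis i 1 = X $ i $ i *s axis i 1"
    using assms(3) by (auto simp: vec_eq_iff diagonal_matrix_vector_mult axis_def)
  then have "G *v (P *v axis i 1) = X $ i $ i *s (P *v axis i 1)"
    by (metis assms(2) matrix_vector_mul_assoc vector_scalar_commute)
  moreover have "inj ((*v) P)"
    using assms(1) by (simp add: invertible_left_inverse matrix_left_invertible_injective)
  then have "P *v axis i 1 \<noteq> 0"
    by (metis axis_eq_0_iff injD matrix_vector_mult_0_right one_neq_zero)
  ultimately show ?thesis using that by blast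
qed

lemma irreducible_pair_commute: "irreducible_pair smul f g \<longleftrightarrow> irreducible_pair smul g f"
  unfolding irreducible_pair_def by blast

text \<open>Dividing an intertwiner by a scalar leaves it an intertwiner, so the transition matrix
  can be normalized before \<open>q\<close> is specialized. A nonzero result is enough for
  irreducibility to make it invertible afterwards.\<close>

lemma specialized_transition_matrix:
  fixes smul :: "ratfun \<Rightarrow> 'v::ab_group_add \<Rightarrow> 'v" and u us :: "'n::finite \<Rightarrow> 'v"
  assumes "vector_space smul" "is_basis smul u" "is_basis smul us"
  obtains P :: "complex ^ 'n ^ 'n" where "P \<noteq> 0"
    "\<And>f. Vector_Spaces.linear smul smul f \<Longrightarrow> matrix_finite_at z (operator_matrix smul u f) \<Longrightarrow>
      matrix_finite_at z (operator_matrix smul us f) \<Longrightarrow>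
      specialize_matrix z (operator_matrix smul u f) ** P = P ** specialize_matrix z (operator_matrix smul us f)"
proof -
  define T where "T = transition_matrix smul u us"
  define S where "S = {T $ i $ j | i j. T $ i $ j \<noteq> 0}"
  have "T \<noteq> 0" unfolding T_def by (rule transition_matrix_nonzero[OF assms])
  then have "S \<noteq> {}" unfolding S_def by (auto simp: vec_eq_iff)
  moreover have "S \<subseteq> range (\<lambda>(i, j). T $ i $ j)" unfolding S_def by auto
  then have "finite S" by (rule finite_subset) simp
  moreover have "0 \<notin> S" unfolding S_def by auto
  ultimately obtain x where x: "x \<in> S" "\<And>y. y \<in> S \<Longrightarrow> finite_at z (y / x)"
    using exists_dominant_element[of S z] by metis
  have "x \<noteq> 0" using x(1) \<open>0 \<notin> S\<close> by auto
  \<comment> \<open>The transition matrix itself may vanish at \<open>z\<close>; after division by its entry of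
    lowest order at \<open>z\<close> it is still finite and takes the value 1 in some entry.\<close>
  define T' where "T' = (\<chi> i j. T $ i $ j / x)"
  have fin: "matrix_finite_at z T'"
    unfolding matrix_finite_at_def
  proof (intro allI)
    fix i j
    show "finite_at z (T' $ i $ j)"
    proof (cases "T $ i $ j = 0")
      case True
      then show ?thesis by (simp add: T'_def specializes_const)
    next
      case False
      then have "T $ i $ j \<in> S" unfolding S_def by blast
      then show ?thesis using x(2) by (simp add: T'_def)
    qed
  qed
  obtain i j where "x = T $ i $ j" using x(1) unfolding S_def by blast
  then have "specialize_matrix z T' $ i $ j = 1"
    using \<open>x \<noteq> 0\<close> by (simp add: specialize_matrix_def T'_def specializes_const)
  then have "specialize_matrix z T' \<noteq> 0" by (metis zero_index zero_neq_one)
  moreover have "specialize_matrix z (operator_matrix smul u f) ** specialize_matrix z T' =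
      specialize_matrix z T' ** specialize_matrix z (operator_matrix smul us f)"
    if f: "Vector_Spaces.linear smul smul f" and fin_f: "matrix_finite_at z (operator_matrix smul u f)"
      "matrix_finite_at z (operator_matrix smul us f)" for f
  proof -
    have "(M ** T') $ i $ j = (M ** T) $ i $ j / x" "(T' ** M) $ i $ j = (T ** M) $ i $ j / x" for M i j
      by (simp_all add: T'_def matrix_matrix_mult_def sum_divide_distrib)
    then have "operator_matrix smul u f ** T' = T' ** operator_matrix smul us f"
      using operator_matrix_transition_matrix[OF assms f] by (simp add: vec_eq_iff T_def)
    then show ?thesis
      using fin fin_f by (simp add: specialize_matrix_mult[symmetric])
  qed
  ultimately show ?thesis using that by blast
qed

theorem corollary3p5:
  fixes smul :: "ratfun \<Rightarrow> 'v::ab_group_add \<Rightarrow> 'v"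
    and A As :: "'v \<Rightarrow> 'v"
    and E Es :: "nat \<Rightarrow> 'v set"
    and a b c as bs cs :: ratfun
    and d N :: nat
    and z :: complex
    and u us :: "'n::finite \<Rightarrow> 'v"
  assumes "vector_space smul"
    and "q_racah_td_pair smul A As d E Es a b c as bs cs"
    and "2 \<le> N" and "N \<le> d"
    and "z = exp (\<i> * of_real pi / of_nat N)"
    and "specialization_assumption smul A As d E Es b c bs cs N z u us"
    and "irreducible_pair vector_scalar_mult (specialized_operator smul z u A) (specialized_operator smul z u As)"
  shows "cyclic_td_pair vector_scalar_mult N (specialized_operator smul z u A) (specialized_operator smul z u As)"
proof -
  note pair = assms(2)[unfolded q_racah_td_pair_def] and spec = assms(6)[unfolded specialization_assumption_def]
  have lin: "Vector_Spaces.linear smul smul A" "Vector_Spaces.linear smul smul As"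
    using pair unfolding td_pair_def by auto
  have bases: "is_basis smul u" "is_basis smul us"
    using spec unfolding adapted_basis_def by auto
  define F G where "F = specialize_matrix z (operator_matrix smul u A)"
    and "G = specialize_matrix z (operator_matrix smul u As)"
  define Ds Xs where "Ds = specialize_matrix z (operator_matrix smul us As)"
    and "Xs = specialize_matrix z (operator_matrix smul us A)"
  have irr: "irreducible_pair (*s) ((*v) F) ((*v) G)"
    using assms(7) unfolding specialized_operator_def F_def G_def .
  obtain P :: "complex ^ 'n ^ 'n" where "P \<noteq> 0" and P: "F ** P = P ** Xs" "G ** P = P ** Ds"
    using specialized_transition_matrix[OF assms(1) bases, of z] lin spec
    unfolding F_def G_def Ds_def Xs_def by metis
  then have inv: "invertible P"
    using irreducible_intertwiner_invertible[OF irr] by blast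
  \<comment> \<open>Coordinates refer to \<open>u\<close>, where \<open>F\<close> is already
    diagonal and \<open>G\<close> block tridiagonal; the identity matrix is therefore the
    intertwiner for the first ordering.\<close>
  have id: "invertible (mat 1 :: complex ^ 'n ^ 'n)" "F ** mat 1 = mat 1 ** F" "G ** mat 1 = mat 1 ** G"
    by (auto simp: invertible_def intro!: exI[of _ "mat 1"])
  obtain k t where k: "{..<N} \<subseteq> range k" and t: "\<And>n. t (n mod N) = t n"
    "inj_on t {..<N} \<or> (\<forall>n. t n = t 0)"
    and F: "\<And>i. F $ i $ i = t (k i)" "diagonal_matrix F" and G: "block_tridiagonal k G"
    using specialized_blocks[OF assms(1) lin(1), of As d E u a b c N z] pair spec assms(3-5)
    unfolding F_def G_def by blast
  obtain ks ts where ks: "{..<N} \<subseteq> range ks" and ts: "\<And>n. ts (n mod N) = ts n"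
    "inj_on ts {..<N} \<or> (\<forall>n. ts n = ts 0)"
    and Ds: "\<And>i. Ds $ i $ i = ts (ks i)" "diagonal_matrix Ds" and Xs: "block_tridiagonal ks Xs"
    using specialized_blocks[OF assms(1) lin(2), of A d Es us as bs cs N z] pair spec assms(3-5)
    unfolding Ds_def Xs_def by blast
  \<comment> \<open>As \<open>N\<close> is at least 2, blocks 0 and 1 are both inhabited, so the
    space has dimension at least two.\<close>
  have "0 \<in> range k" "1 \<in> range k" using k assms(3) by auto
  then obtain i j where "k i = 0" "k j = 1" by (metis imageE)
  then have ij: "i \<noteq> j" by auto
  \<comment> \<open>Otherwise \<open>t\<close> is constant and \<open>F\<close> is scalar, while a
    column of \<open>P\<close> is an eigenvector of \<open>G\<close>.\<close>
  have "inj_on t {..<N}"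
  proof (rule ccontr)
    assume "\<not> ?thesis"
    then have "F *v w = t 0 *s w" for w
      using scalar_from_intertwiner[OF id(1,2) F(2)] F(1) t(2) by metis
    moreover obtain v \<mu> where "G *v v = \<mu> *s v" "v \<noteq> 0"
      using diagonal_eigenvector[OF inv P(2) Ds(2)] by blast
    ultimately show False
      using scalar_with_eigenvector_reducible[OF _ _ _ ij] irr by blast
  qed
  \<comment> \<open>Here \<open>G\<close> would be conjugate by \<open>P\<close> to a scalar matrix,
    hence scalar, and a unit vector is an eigenvector of the diagonal \<open>F\<close>.\<close>
  have "inj_on ts {..<N}"
  proof (rule ccontr)
    assume "\<not> ?thesis"
    then have "G *v w = ts 0 *s w" for w
      using scalar_from_intertwiner[OF inv P(2) Ds(2)] Ds(1) ts(2) by metis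
    moreover obtain v \<mu> where "F *v v = \<mu> *s v" "v \<noteq> 0"
      using diagonal_eigenvector[OF id(1,2) F(2)] by blast
    ultimately show False
      using scalar_with_eigenvector_reducible[OF _ _ _ ij] irr irreducible_pair_commute by blast
  qed
  have "0 < N" using assms(3) by simp
  have "finite_dim_nonzero ((*s) :: complex \<Rightarrow> complex ^ 'n \<Rightarrow> _)"
    unfolding finite_dim_nonzero_def
    using finite_cart_basis span_cart_basis by (metis axis_eq_0_iff one_neq_zero)
  \<comment> \<open>The first ordering comes from the unit vectors, the second from the columns of
    \<open>P\<close>, in which \<open>G\<close> becomes \<open>Ds\<close> and \<open>F\<close>
    becomes \<open>Xs\<close>.\<close>
  moreover note cyclic_ordering_of_diagonalization[OF \<open>0 < N\<close> id F(2,1) G t(1) \<open>inj_on t _\<close> k]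
    cyclic_ordering_of_diagonalization[OF \<open>0 < N\<close> inv P(2,1) Ds(2,1) Xs ts(1) \<open>inj_on ts _\<close> ks]
  ultimately have "cyclic_td_pair (*s) N ((*v) F) ((*v) G)"
    using irr unfolding cyclic_td_pair_def by (simp add: matrix_vector_mul_linear_gen)
  then show ?thesis
    unfolding specialized_operator_def F_def G_def .
qed

end
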